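(* Let $k$ be a positive integer, let $\mathcal{G}$ be a hereditary class of graphs, and let $G$ be a graph in $\mathcal{G}^k$. Then either $G \in \mathcal{G}$, or $G$ admits a cut-partition $(A,B,C)$ such that $G[A] \in \mathcal{G}$ and $|C| \leq 2k^2-1$.
   Context: All graphs are finite, simple, and non-null. A class of graphs is hereditary if it is closed under taking induced subgraphs and under isomorphism. A graph $G$ is obtained from graphs $G_1$ and $G_2$ by gluing along at most $k$ vertices if $G_1[V(G_1)\cap V(G_2)] = G_2[V(G_1)\cap V(G_2)]$, $|V(G_1)\cap V(G_2)| \leq k$, and $G = G_1 \cup G_2$ (the intersection may be empty). For a class $\mathcal{G}$ of graphs, the $k$-closure $\mathcal{G}^k$ is the inclusion-wise smallest class that includes $\mathcal{G}$ and is closed under the operation of gluing along at most $k$ vertices. A cut-partition of a graph $G$ is a partition $(A,B,C)$ of $V(G)$ such that $A$ and $B$ are non-empty ($C$ may be empty) and there are no edges of $G$ between $A$ and $B$. *)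

theory Defs
  imports "Graph_Theory.Digraph_Isomorphism"
begin

text \<open>
  A finite simple graph is a \<open>pair_graph\<close>: an irreflexive symmetric arc relation on a
  finite vertex set.  That locale admits the null graph, which is excluded here.
\<close>

definition nonnull_graph :: "'a pair_pre_digraph \<Rightarrow> bool" where
  "nonnull_graph G \<longleftrightarrow> pair_graph G \<and> pverts G \<noteq> {}"

text \<open>
  Counterparts of \<open>induce_subgraph\<close> and \<open>union\<close> that stay inside the type of pair graphs.
\<close>

definition pair_induce :: "'a pair_pre_digraph \<Rightarrow> 'a set \<Rightarrow> 'a pair_pre_digraph" where
  "pair_induce G S = \<lparr> pverts = S, parcs = {e \<in> parcs G. fst e \<in> S \<and> snd e \<in> S} \<rparr>"

definition pair_union ::
    "'a pair_pre_digraph \<Rightarrow> 'a pair_pre_digraph \<Rightarrow> 'a pair_pre_digraph" where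
  "pair_union G H = \<lparr> pverts = pverts G \<union> pverts H, parcs = parcs G \<union> parcs H \<rparr>"

lemma with_proj_pair_induce: "with_proj (pair_induce G S) = with_proj G \<restriction> S"
  by (simp add: pair_induce_def induce_subgraph_def with_proj_def)

lemma with_proj_pair_union: "with_proj (pair_union G H) = union (with_proj G) (with_proj H)"
  by (simp add: pair_union_def union_def with_proj_def)

definition hereditary :: "'a pair_pre_digraph set \<Rightarrow> bool" where
  "hereditary \<G> \<longleftrightarrow>
     (\<forall>G\<in>\<G>. nonnull_graph G) \<and>
     (\<forall>G\<in>\<G>. \<forall>H. nonnull_graph H \<and> induced_subgraph (with_proj H) (with_proj G) \<longrightarrow> H \<in> \<G>) \<and>
     (\<forall>G\<in>\<G>. \<forall>H. nonnull_graph H \<and> digraph_iso (with_proj G) (with_proj H) \<longrightarrow> H \<in> \<G>)"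

text \<open>\<open>glued k G1 G2 G\<close>: \<open>G\<close> is obtained from \<open>G1\<close> and \<open>G2\<close> by gluing along at most \<open>k\<close> vertices.\<close>

definition glued ::
    "nat \<Rightarrow> 'a pair_pre_digraph \<Rightarrow> 'a pair_pre_digraph \<Rightarrow> 'a pair_pre_digraph \<Rightarrow> bool" where
  "glued k G1 G2 G \<longleftrightarrow>
     nonnull_graph G1 \<and> nonnull_graph G2 \<and>
     pair_induce G1 (pverts G1 \<inter> pverts G2) = pair_induce G2 (pverts G1 \<inter> pverts G2) \<and>
     card (pverts G1 \<inter> pverts G2) \<le> k \<and>
     G = pair_union G1 G2"

inductive_set k_closure :: "nat \<Rightarrow> 'a pair_pre_digraph set \<Rightarrow> 'a pair_pre_digraph set"
  for k :: nat and \<G> :: "'a pair_pre_digraph set" where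
  base: "G \<in> \<G> \<Longrightarrow> G \<in> k_closure k \<G>"
| glue: "G1 \<in> k_closure k \<G> \<Longrightarrow> G2 \<in> k_closure k \<G> \<Longrightarrow> glued k G1 G2 G \<Longrightarrow> G \<in> k_closure k \<G>"

text \<open>The arc relation of a graph is symmetric, so one direction of non-adjacency suffices.\<close>

definition cut_partition ::
    "'a pair_pre_digraph \<Rightarrow> 'a set \<Rightarrow> 'a set \<Rightarrow> 'a set \<Rightarrow> bool" where
  "cut_partition G A B C \<longleftrightarrow>
     A \<union> B \<union> C = pverts G \<and> A \<inter> B = {} \<and> A \<inter> C = {} \<and> B \<inter> C = {} \<and>
     A \<noteq> {} \<and> B \<noteq> {} \<and>
     (\<forall>u\<in>A. \<forall>v\<in>B. (u, v) \<notin> parcs G)"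

end

theory Submission
  imports Defs
begin

text \<open>
  Every graph in the \<open>k\<close>-closure of \<open>\<G>\<close> that is not itself in \<open>\<G>\<close> has a cut-partition whose
  cutset has at most \<open>k\<close> vertices, and the \<open>k\<close>-closure inherits closure under induced subgraphs
  from \<open>\<G>\<close>. So an induced subgraph of \<open>G\<close> without a cut-partition of order at most \<open>k\<close> lies in
  \<open>\<G>\<close>, and it suffices to find such a subgraph \<open>G[X]\<close> in which at most \<open>2k\<^sup>2 - 1\<close> vertices have
  neighbours outside \<open>X\<close>: these vertices form \<open>C\<close>, the other vertices of \<open>X\<close> form \<open>A\<close>, and the
  complement of \<open>X\<close> is \<open>B\<close>. This is done for graphs of minimum degree at least \<open>2k\<^sup>2\<close>. In any
  other graph a single vertex can serve as \<open>A\<close>, because the one-vertex induced subgraphs lie in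
  \<open>\<G>\<close>: a vertex of degree below \<open>2k\<^sup>2\<close> is cut off by its neighbours, unless \<open>G\<close> has at most
  \<open>2k\<^sup>2\<close> vertices, in which case two non-adjacent vertices are separated by all the others.

  The set \<open>X\<close> comes from a weighted minimality argument. A vertex \<open>v\<close> of \<open>X\<close> is charged the number
  of its neighbours outside \<open>X\<close>, but never more than \<open>k\<close>, and \<open>X\<close> is taken minimal subject to
  having total charge at most \<open>2k\<^sup>2 - 1\<close> and containing a vertex charged less than \<open>k\<close>. Suppose
  that \<open>G[X]\<close> has a cut-partition \<open>(A,B,C)\<close> with \<open>|C| \<le> k\<close>. One side, say \<open>A\<close>, carries charge at
  most \<open>k\<^sup>2 - 1\<close>. Passing to \<open>A \<union> C\<close> alters charges in \<open>C\<close> only, so the total is at most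
  \<open>k\<^sup>2 - 1 + k\<cdot>k\<close>, and by minimality every vertex of \<open>A\<close> is charged exactly \<open>k\<close>. Deleting \<open>A\<close> then
  saves \<open>k|A|\<close>, while each of the at most \<open>k\<close> vertices of \<open>C\<close> pays at most \<open>|A|\<close> more, so the
  total charge of \<open>B \<union> C\<close> is no larger than that of \<open>X\<close>; by minimality, all vertices of \<open>B \<union> C\<close>
  are charged \<open>k\<close> there. Bounded totals of charges \<open>k\<close> make both \<open>A\<close> and \<open>B \<union> C\<close> small, yet \<open>X\<close> has
  a vertex with fewer than \<open>k\<close> of its at least \<open>2k\<^sup>2\<close> neighbours outside \<open>X\<close>.
\<close>

section \<open>Induced subgraphs and cut-partitions\<close>

lemma pair_graph_iff:
  "pair_graph G \<longleftrightarrow> finite (pverts G) \<and> parcs G \<subseteq> pverts G \<times> pverts G \<and>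
     sym (parcs G) \<and> (\<forall>u. (u, u) \<notin> parcs G)"
  (is "_ \<longleftrightarrow> ?R")
proof
  assume "pair_graph G"
  then interpret pair_graph G .
  show ?R
    using pair_finite_verts in_arcsD1 in_arcsD2 pair_sym_arcs pair_no_loops
    by (fastforce simp: symmetric_def)
next
  assume R: ?R
  then have "finite (parcs G)"
    by (meson finite_SigmaI finite_subset)
  moreover have "symmetric G"
    using R by (simp add: symmetric_def)
  moreover have "finite (pverts G)"
    using R by simp
  moreover have "fst e \<in> pverts G" "snd e \<in> pverts G" "fst e \<noteq> snd e" if "e \<in> parcs G" for e
    using R that by (cases e; auto)+
  ultimately show "pair_graph G"
    by unfold_locales
qed

lemma pair_induce_simps [simp]:
  "pverts (pair_induce G S) = S"
  "parcs (pair_induce G S) = {e \<in> parcs G. fst e \<in> S \<and> snd e \<in> S}"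
  by (simp_all add: pair_induce_def)

lemma sym_parcs_pair_induce:
  assumes "sym (parcs G)"
  shows "sym {e \<in> parcs G. fst e \<in> S \<and> snd e \<in> S}"
  by (rule symI) (auto intro: symD[OF assms])

lemma pair_graph_pair_induce:
  assumes "pair_graph G" "S \<subseteq> pverts G"
  shows "pair_graph (pair_induce G S)"
  using assms finite_subset[of S "pverts G"] sym_parcs_pair_induce[of G S]
  by (auto simp: pair_graph_iff)

lemma pair_induce_induce: "T \<subseteq> S \<Longrightarrow> pair_induce (pair_induce G S) T = pair_induce G T"
  by (auto simp: pair_induce_def)

lemma pair_induce_pverts:
  assumes "pair_graph G"
  shows "pair_induce G (pverts G) = G"
proof (rule pair_pre_digraph.equality)
  show "parcs (pair_induce G (pverts G)) = parcs G"
    using assms by (auto simp: pair_graph_iff)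
qed simp_all

lemma nonnull_graph_pair_induce:
  assumes "nonnull_graph G" "S \<subseteq> pverts G" "S \<noteq> {}"
  shows "nonnull_graph (pair_induce G S)"
  using assms by (simp add: nonnull_graph_def pair_graph_pair_induce)

lemma hereditary_pair_induce:
  assumes "hereditary \<G>" "G \<in> \<G>" "S \<subseteq> pverts G" "S \<noteq> {}"
  shows "pair_induce G S \<in> \<G>"
proof -
  have G: "nonnull_graph G"
    using assms(1,2) unfolding hereditary_def by blast
  then interpret pair_graph G
    by (simp add: nonnull_graph_def)
  have "induced_subgraph (with_proj (pair_induce G S)) (with_proj G)"
    unfolding with_proj_pair_induce using assms(3) by (rule induced_induce)
  with nonnull_graph_pair_induce[OF G assms(3,4)] show ?thesis
    using assms(1,2) unfolding hereditary_def by (elim conjE) (drule bspec, assumption, meson)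
qed

lemma cut_partition_sym:
  assumes "pair_graph G" "cut_partition G A B C"
  shows "cut_partition G B A C"
proof -
  have "(u, v) \<notin> parcs G" if "u \<in> B" "v \<in> A" for u v
    using assms that symD[of "parcs G" u v] by (auto simp: pair_graph_iff cut_partition_def)
  then show ?thesis
    using assms(2) by (auto simp: cut_partition_def)
qed

section \<open>The closure under gluing\<close>

lemma nonnull_graph_pair_union:
  assumes "nonnull_graph G1" "nonnull_graph G2"
  shows "nonnull_graph (pair_union G1 G2)"
  using assms sym_Un[of "parcs G1" "parcs G2"]
  by (auto simp: nonnull_graph_def pair_graph_iff pair_union_def)

lemma nonnull_graph_k_closure:
  assumes "hereditary \<G>" "G \<in> k_closure k \<G>"
  shows "nonnull_graph G"
  using assms(2,1)
proof induction
  case (base G)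
  then show ?case
    unfolding hereditary_def by blast
qed (simp add: glued_def nonnull_graph_pair_union)

lemma glued_sym: "glued k G1 G2 G \<Longrightarrow> glued k G2 G1 G"
  by (auto simp: glued_def pair_union_def Int_commute Un_commute)

text \<open>
  The two graphs agree on their common vertices, so gluing creates no arcs inside either of them.
\<close>

lemma glued_induce_left:
  assumes "glued k G1 G2 G" "S \<subseteq> pverts G1"
  shows "pair_induce G S = pair_induce G1 S"
proof -
  have "(u, v) \<in> parcs G1"
    if "(u, v) \<in> parcs G2" "u \<in> S" "v \<in> S" for u v
  proof -
    let ?I = "pverts G1 \<inter> pverts G2"
    have "(u, v) \<in> parcs (pair_induce G2 ?I)"
      using that assms by (auto simp: glued_def nonnull_graph_def pair_graph_iff)
    then have "(u, v) \<in> parcs (pair_induce G1 ?I)"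
      using assms(1) by (simp only: glued_def)
    then show ?thesis
      by simp
  qed
  then show ?thesis
    using assms by (auto simp: glued_def pair_induce_def pair_union_def)
qed

lemma glued_induce_right:
  assumes "glued k G1 G2 G" "S \<subseteq> pverts G2"
  shows "pair_induce G S = pair_induce G2 S"
  using glued_induce_left[OF glued_sym] assms .

lemma glued_pair_induce:
  assumes gl: "glued k G1 G2 G" and "S \<subseteq> pverts G"
    and ne: "S \<inter> pverts G1 \<noteq> {}" "S \<inter> pverts G2 \<noteq> {}"
  shows "glued k (pair_induce G1 (S \<inter> pverts G1)) (pair_induce G2 (S \<inter> pverts G2))
           (pair_induce G S)"
proof -
  let ?S1 = "S \<inter> pverts G1" and ?S2 = "S \<inter> pverts G2"
  have nn: "nonnull_graph G1" "nonnull_graph G2" and G: "G = pair_union G1 G2"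
    using gl by (auto simp: glued_def)
  have fin: "finite (pverts G1)"
    using nn by (simp add: nonnull_graph_def pair_graph_iff)
  have "pair_induce (pair_induce G1 ?S1) (?S1 \<inter> ?S2) = pair_induce G (?S1 \<inter> ?S2)"
    by (simp add: pair_induce_induce glued_induce_left[OF gl] le_infI1 le_infI2)
  moreover have "pair_induce (pair_induce G2 ?S2) (?S1 \<inter> ?S2) = pair_induce G (?S1 \<inter> ?S2)"
    by (simp add: pair_induce_induce glued_induce_right[OF gl] le_infI1 le_infI2)
  moreover have "card (?S1 \<inter> ?S2) \<le> k"
  proof -
    have "card (?S1 \<inter> ?S2) \<le> card (pverts G1 \<inter> pverts G2)"
      using fin by (intro card_mono) auto
    then show ?thesis
      using gl by (simp add: glued_def)
  qed
  moreover have "pair_induce G S = pair_union (pair_induce G1 ?S1) (pair_induce G2 ?S2)"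
  proof (rule pair_pre_digraph.equality)
    show "pverts (pair_induce G S) = pverts (pair_union (pair_induce G1 ?S1) (pair_induce G2 ?S2))"
      using assms(2) G by (auto simp: pair_union_def)
    show "parcs (pair_induce G S) = parcs (pair_union (pair_induce G1 ?S1) (pair_induce G2 ?S2))"
      using nn G by (auto simp: pair_union_def nonnull_graph_def pair_graph_iff)
  qed simp
  ultimately show ?thesis
    using nn ne by (simp add: glued_def nonnull_graph_pair_induce)
qed

lemma k_closure_pair_induce:
  assumes "hereditary \<G>" "G \<in> k_closure k \<G>" "S \<subseteq> pverts G" "S \<noteq> {}"
  shows "pair_induce G S \<in> k_closure k \<G>"
  using assms(2,3,4)
proof (induction arbitrary: S)
  case (base G)
  then show ?case
    using hereditary_pair_induce[OF assms(1)] k_closure.base by blast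
next
  case (glue G1 G2 G)
  have V: "pverts G = pverts G1 \<union> pverts G2"
    using glue.hyps by (auto simp: glued_def pair_union_def)
  consider "S \<subseteq> pverts G1" | "S \<subseteq> pverts G2"
    | "S \<inter> pverts G1 \<noteq> {}" "S \<inter> pverts G2 \<noteq> {}"
    using V glue.prems by blast
  then show ?case
  proof cases
    case 1
    then show ?thesis
      using glue.IH(1)[of S] glued_induce_left[OF glue.hyps(3)] glue.prems(2) by simp
  next
    case 2
    then show ?thesis
      using glue.IH(2)[of S] glued_induce_right[OF glue.hyps(3)] glue.prems(2) by simp
  next
    case 3
    show ?thesis
      using glue.IH(1)[OF Int_lower2 3(1)] glue.IH(2)[OF Int_lower2 3(2)]
        glued_pair_induce[OF glue.hyps(3) glue.prems(1) 3]
      by (rule k_closure.glue)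
  qed
qed

text \<open>
  The last proper gluing step provides the cutset; a step in which one vertex set contains
  the other returns the larger graph unchanged.
\<close>

lemma k_closure_cut_partition:
  assumes "hereditary \<G>" "G \<in> k_closure k \<G>"
  shows "G \<in> \<G> \<or> (\<exists>A B C. cut_partition G A B C \<and> card C \<le> k)"
  using assms(2)
proof induction
  case (glue G1 G2 G)
  note gl = glue.hyps(3)
  have V: "pverts G = pverts G1 \<union> pverts G2"
    and pg: "pair_graph G1" "pair_graph G2" "pair_graph G"
    using gl nonnull_graph_pair_union by (auto simp: glued_def pair_union_def nonnull_graph_def)
  consider "pverts G1 \<subseteq> pverts G2" | "pverts G2 \<subseteq> pverts G1"
    | "\<not> pverts G1 \<subseteq> pverts G2" "\<not> pverts G2 \<subseteq> pverts G1"
    by blast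
  then show ?case
  proof cases
    case 1
    then have "pverts G = pverts G2"
      using V by blast
    then have "G = G2"
      using glued_induce_right[OF gl order_refl] pair_induce_pverts[OF pg(2)]
        pair_induce_pverts[OF pg(3)]
      by metis
    then show ?thesis
      using glue.IH by simp
  next
    case 2
    then have "pverts G = pverts G1"
      using V by blast
    then have "G = G1"
      using glued_induce_left[OF gl order_refl] pair_induce_pverts[OF pg(1)]
        pair_induce_pverts[OF pg(3)]
      by metis
    then show ?thesis
      using glue.IH by simp
  next
    case 3
    have "cut_partition G (pverts G1 - pverts G2) (pverts G2 - pverts G1) (pverts G1 \<inter> pverts G2)"
      using 3 gl by (auto simp: cut_partition_def glued_def pair_union_def nonnull_graph_def
          pair_graph_iff)
    moreover have "card (pverts G1 \<inter> pverts G2) \<le> k"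
      using gl by (simp add: glued_def)
    ultimately show ?thesis
      by blast
  qed
qed simp

section \<open>Isolating a subgraph without small cutsets\<close>

definition nbrs_outside :: "'a pair_pre_digraph \<Rightarrow> 'a set \<Rightarrow> 'a \<Rightarrow> 'a set" where
  "nbrs_outside G X v = {u. (v, u) \<in> parcs G} - X"

text \<open>
  Truncation at \<open>k\<close> bounds what \<open>k\<close> new cut vertices can cost by \<open>k\<^sup>2\<close>.
\<close>

definition charge :: "nat \<Rightarrow> 'a pair_pre_digraph \<Rightarrow> 'a set \<Rightarrow> 'a \<Rightarrow> nat" where
  "charge k G X v = min k (card (nbrs_outside G X v))"

lemma finite_nbrs_outside: "pair_graph G \<Longrightarrow> finite (nbrs_outside G X v)"
  by (rule finite_subset[of _ "pverts G"]) (auto simp: nbrs_outside_def pair_graph_iff)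

lemma charge_cut_side:
  assumes "cut_partition (pair_induce G X) A B C" "v \<in> A"
  shows "charge k G (A \<union> C) v = charge k G X v"
proof -
  have "nbrs_outside G (A \<union> C) v = nbrs_outside G X v"
    using assms by (auto simp: nbrs_outside_def cut_partition_def)
  then show ?thesis
    by (simp add: charge_def)
qed

lemma charge_remove_le:
  assumes "pair_graph G" "finite A"
  shows "charge k G X v \<le> charge k G (X \<union> A) v + card A"
proof -
  have "nbrs_outside G X v \<subseteq> nbrs_outside G (X \<union> A) v \<union> A"
    by (auto simp: nbrs_outside_def)
  then have "card (nbrs_outside G X v) \<le> card (nbrs_outside G (X \<union> A) v \<union> A)"
    using assms by (intro card_mono) (auto simp: finite_nbrs_outside)
  then show ?thesis
    using card_Un_le[of "nbrs_outside G (X \<union> A) v" A] by (auto simp: charge_def)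
qed

text \<open>
  A vertex has at most \<open>|X| - 1\<close> neighbours in \<open>X\<close>, as it is not its own neighbour. The \<open>1\<close>
  is what later separates \<open>2k\<^sup>2\<close> from \<open>2k\<^sup>2 - 1\<close>.
\<close>

lemma degree_less_card_plus_outside:
  assumes "pair_graph G" "finite X" "v \<in> X"
  shows "card (nbrs_outside G {} v) < card X + card (nbrs_outside G X v)"
proof -
  have "nbrs_outside G {} v \<subseteq> (X - {v}) \<union> nbrs_outside G X v"
    using assms by (auto simp: nbrs_outside_def pair_graph_iff)
  then have "card (nbrs_outside G {} v) \<le> card ((X - {v}) \<union> nbrs_outside G X v)"
    using assms by (intro card_mono) (auto simp: finite_nbrs_outside)
  also have "\<dots> \<le> card (X - {v}) + card (nbrs_outside G X v)"
    by (rule card_Un_le)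
  also have "\<dots> < card X + card (nbrs_outside G X v)"
    using card_Diff1_less[OF assms(2,3)] by simp
  finally show ?thesis .
qed

text \<open>
  Both \<open>A \<union> C\<close> and \<open>B \<union> C\<close> have total charge at most \<open>2k\<^sup>2 - 1\<close>, so by minimality all their
  vertices are charged \<open>k\<close>, which leaves too few vertices in \<open>X\<close> for the neighbours of \<open>x\<close>. The
  bound for \<open>B \<union> C\<close> depends on that for \<open>A \<union> C\<close>: only because each vertex of \<open>A\<close> carries the
  full charge \<open>k\<close> does its deletion pay for the arcs to \<open>C\<close> that it turns outward.
\<close>

lemma no_light_cut_side:
  fixes G :: "'a pair_pre_digraph"
  assumes G: "pair_graph G" and X: "X \<subseteq> pverts G" and k: "k \<ge> 1"
    and deg: "\<And>v. v \<in> X \<Longrightarrow> 2 * k\<^sup>2 \<le> card (nbrs_outside G {} v)"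
    and total: "sum (charge k G X) X \<le> 2 * k\<^sup>2 - 1"
    and low: "x \<in> X" "charge k G X x < k"
    and minimal: "\<And>Y v. Y \<subset> X \<Longrightarrow> sum (charge k G Y) Y \<le> 2 * k\<^sup>2 - 1 \<Longrightarrow> v \<in> Y \<Longrightarrow>
      charge k G Y v = k"
    and cut: "cut_partition (pair_induce G X) A B C" and small: "card C \<le> k"
    and light: "sum (charge k G X) A \<le> k\<^sup>2 - 1"
  shows False
proof -
  have parts: "X = A \<union> B \<union> C" "A \<inter> B = {}" "A \<inter> C = {}" "B \<inter> C = {}" "A \<noteq> {}" "B \<noteq> {}"
    using cut by (auto simp: cut_partition_def)
  have finX: "finite X"
    using X G finite_subset by (auto simp: pair_graph_iff)
  then have fin: "finite A" "finite B" "finite C"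
    using parts by auto
  have indG: "pair_graph (pair_induce G X)"
    using G X by (simp add: pair_graph_pair_induce)
  have cut': "cut_partition (pair_induce G X) B A C"
    using cut_partition_sym[OF indG cut] .
  have ksq: "k * k = k\<^sup>2" "k * (2 * k) = 2 * k\<^sup>2" "k\<^sup>2 \<ge> 1"
    using k by (auto simp: power2_eq_square)
  have A_full: "charge k G X v = k" if "v \<in> A" for v
  proof -
    have "sum (charge k G (A \<union> C)) (A \<union> C)
        = sum (charge k G (A \<union> C)) A + sum (charge k G (A \<union> C)) C"
      using parts fin by (intro sum.union_disjoint) auto
    also have "sum (charge k G (A \<union> C)) A = sum (charge k G X) A"
      using charge_cut_side[OF cut] by (intro sum.cong) auto
    also have "sum (charge k G (A \<union> C)) C \<le> card C * k"
      using sum_bounded_above[of C "charge k G (A \<union> C)" k] by (simp add: charge_def)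
    also have "card C * k \<le> k\<^sup>2"
      using small by (simp flip: ksq(1))
    finally have "sum (charge k G (A \<union> C)) (A \<union> C) \<le> 2 * k\<^sup>2 - 1"
      using light ksq by simp
    then have "charge k G (A \<union> C) v = k"
      using minimal[of "A \<union> C" v] parts that by blast
    then show ?thesis
      using charge_cut_side[OF cut that] by simp
  qed
  have A_sum: "sum (charge k G X) A = k * card A"
    using A_full by (simp add: mult.commute)
  have rest_total: "sum (charge k G (B \<union> C)) (B \<union> C) \<le> 2 * k\<^sup>2 - 1"
  proof -
    have "sum (charge k G (B \<union> C)) (B \<union> C)
        = sum (charge k G (B \<union> C)) B + sum (charge k G (B \<union> C)) C"
      using parts fin by (intro sum.union_disjoint) auto
    also have "sum (charge k G (B \<union> C)) B = sum (charge k G X) B"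
      using charge_cut_side[OF cut'] by (intro sum.cong) auto
    also have "sum (charge k G (B \<union> C)) C \<le> (\<Sum>c\<in>C. charge k G X c + card A)"
    proof (rule sum_mono)
      have "B \<union> C \<union> A = X"
        using parts by auto
      then show "charge k G (B \<union> C) c \<le> charge k G X c + card A" for c
        using charge_remove_le[OF G fin(1), of k "B \<union> C" c] by simp
    qed
    also have "\<dots> = sum (charge k G X) C + card C * card A"
      by (simp add: sum.distrib)
    also have "\<dots> \<le> sum (charge k G X) C + sum (charge k G X) A"
      using small by (simp add: A_sum)
    also have "sum (charge k G X) B + (sum (charge k G X) C + sum (charge k G X) A)
        = sum (charge k G X) X"
    proof -
      have "sum (charge k G X) X = sum (charge k G X) (A \<union> B) + sum (charge k G X) C"
        using parts fin by (subst parts(1), intro sum.union_disjoint) auto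
      also have "sum (charge k G X) (A \<union> B) = sum (charge k G X) A + sum (charge k G X) B"
        using parts fin by (intro sum.union_disjoint) auto
      finally show ?thesis
        by simp
    qed
    finally show ?thesis
      using total by simp
  qed
  have "charge k G (B \<union> C) v = k" if "v \<in> B \<union> C" for v
    using minimal[of "B \<union> C" v] rest_total parts that by blast
  then have "sum (charge k G (B \<union> C)) (B \<union> C) = k * card (B \<union> C)"
    by (simp add: mult.commute)
  then have "k * card (B \<union> C) < k * (2 * k)"
    using rest_total ksq(2,3) by linarith
  then have "card (B \<union> C) < 2 * k"
    by simp
  moreover have "card A < k"
  proof -
    have "k * card A < k * k"
      using light ksq(1,3) A_sum by linarith
    then show ?thesis
      by simp
  qed
  moreover have "card X \<le> card A + card (B \<union> C)"
    using card_Un_le[of A "B \<union> C"] by (simp add: parts(1) Un_assoc)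
  moreover have "2 * k\<^sup>2 < card X + k"
    using degree_less_card_plus_outside[OF G finX low(1)] deg[OF low(1)] low(2)
    by (simp add: charge_def)
  ultimately have "2 * k\<^sup>2 + 2 < 4 * k"
    by linarith
  \<comment> \<open>This says \<open>2(k - 1)\<^sup>2 < 0\<close>.\<close>
  moreover have "4 * k \<le> 2 * k\<^sup>2 + 2"
  proof -
    obtain j where "k = Suc j"
      using k by (cases k) auto
    then show ?thesis
      by (simp add: power2_eq_square)
  qed
  ultimately show False
    by simp
qed

text \<open>
  If every vertex of \<open>X\<close> had neighbours outside, the least charge \<open>m\<close> would be positive, and
  since \<open>m < k\<close>, a vertex attaining it has exactly \<open>m\<close> neighbours outside. The degree condition gives \<open>|X| + (m - 1) \<ge> 2k\<^sup>2\<close>, and the total charge is at least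
  \<open>m|X| \<ge> |X| + (m - 1)\<close>.
\<close>

lemma low_charge_imp_interior:
  assumes G: "pair_graph G" and fin: "finite X"
    and deg: "\<And>v. v \<in> X \<Longrightarrow> 2 * k\<^sup>2 \<le> card (nbrs_outside G {} v)"
    and total: "sum (charge k G X) X \<le> 2 * k\<^sup>2 - 1"
    and low: "x \<in> X" "charge k G X x < k"
  shows "\<exists>v\<in>X. nbrs_outside G X v = {}"
proof (rule ccontr)
  assume none: "\<not> (\<exists>v\<in>X. nbrs_outside G X v = {})"
  obtain y where y: "y \<in> X" and y_min: "\<And>v. v \<in> X \<Longrightarrow> charge k G X y \<le> charge k G X v"
    using ex_has_least_nat[of "\<lambda>v. v \<in> X" x "charge k G X"] low(1) by blast
  define m where "m = charge k G X y"
  have "m < k"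
    using y_min[OF low(1)] low(2) by (simp add: m_def)
  then have m: "card (nbrs_outside G X y) = m"
    by (auto simp: m_def charge_def)
  have "nbrs_outside G X y \<noteq> {}"
    using none y by blast
  then have "m > 0"
    using m finite_nbrs_outside[OF G, of X y] by (simp flip: m add: card_gt_0_iff)
  then obtain j where j: "m = Suc j"
    by (cases m) auto
  have ksq: "m \<le> k\<^sup>2"
    using \<open>m < k\<close> le_square[of k] unfolding power2_eq_square by linarith
  have size: "2 * k\<^sup>2 < card X + m"
    using degree_less_card_plus_outside[OF G fin y] deg[OF y] m by simp
  have "2 * k\<^sup>2 \<le> card X + j"
    using size j by simp
  also have "\<dots> \<le> card X + j * card X"
  proof -
    have "card X \<ge> 1"
      using size ksq \<open>m > 0\<close> by linarith
    then show ?thesis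
      by simp
  qed
  also have "\<dots> = card X * m"
    by (simp add: j)
  also have "\<dots> \<le> sum (charge k G X) X"
    using sum_bounded_below[of X m "charge k G X"] y_min by (simp add: m_def)
  finally show False
    using total ksq \<open>m > 0\<close> by linarith
qed

text \<open>
  A form of Mader's theorem that large minimum degree forces a highly connected subgraph; here
  the subgraph moreover has few vertices with neighbours outside it.
\<close>

theorem isolated_subgraph_without_small_cut:
  fixes G :: "'a pair_pre_digraph"
  assumes G: "pair_graph G" "pverts G \<noteq> {}" and k: "k \<ge> 1"
    and deg: "\<And>v. v \<in> pverts G \<Longrightarrow> 2 * k\<^sup>2 \<le> card (nbrs_outside G {} v)"
  obtains X where "X \<subseteq> pverts G" "\<exists>v\<in>X. nbrs_outside G X v = {}"
    "card {v \<in> X. nbrs_outside G X v \<noteq> {}} \<le> 2 * k\<^sup>2 - 1"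
    "\<nexists>A B C. cut_partition (pair_induce G X) A B C \<and> card C \<le> k"
proof -
  define admissible where "admissible X \<longleftrightarrow> X \<subseteq> pverts G \<and>
    sum (charge k G X) X \<le> 2 * k\<^sup>2 - 1 \<and> (\<exists>v\<in>X. charge k G X v < k)" for X
  have finV: "finite (pverts G)"
    using G by (simp add: pair_graph_iff)
  have "nbrs_outside G (pverts G) v = {}" for v
    using G by (auto simp: nbrs_outside_def pair_graph_iff)
  then have "admissible (pverts G)"
    using G k by (auto simp: admissible_def charge_def)
  then obtain X where X: "admissible X" and "\<And>Y. admissible Y \<Longrightarrow> card X \<le> card Y"
    using ex_has_least_nat[of admissible "pverts G" card] by blast
  then have X_min: "\<not> admissible Y" if "Y \<subset> X" for Y
    using that finV by (metis admissible_def finite_subset not_le psubset_card_mono)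
  have sub: "X \<subseteq> pverts G" and total: "sum (charge k G X) X \<le> 2 * k\<^sup>2 - 1"
    using X by (auto simp: admissible_def)
  obtain x where x: "x \<in> X" "charge k G X x < k"
    using X by (auto simp: admissible_def)
  have finX: "finite X"
    using sub finV finite_subset by blast
  have indG: "pair_graph (pair_induce G X)"
    using G sub by (simp add: pair_graph_pair_induce)
  have minimal: "charge k G Y v = k"
    if "Y \<subset> X" "sum (charge k G Y) Y \<le> 2 * k\<^sup>2 - 1" "v \<in> Y" for Y v
    using X_min[OF that(1)] that sub unfolding admissible_def charge_def
    by (metis min.cobounded1 nat_less_le order.trans psubsetE)
  have no_light: "\<not> sum (charge k G X) A \<le> k\<^sup>2 - 1"
    if "cut_partition (pair_induce G X) A B C" "card C \<le> k" for A B C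
    using no_light_cut_side[OF G(1) sub k _ total x minimal that] deg sub by blast
  have "\<nexists>A B C. cut_partition (pair_induce G X) A B C \<and> card C \<le> k"
  proof (intro notI, elim exE conjE)
    fix A B C
    assume cut: "cut_partition (pair_induce G X) A B C" and small: "card C \<le> k"
    have "sum (charge k G X) A + sum (charge k G X) B = sum (charge k G X) (A \<union> B)"
      using cut finX by (intro sum.union_disjoint[symmetric]) (auto simp: cut_partition_def)
    also have "\<dots> \<le> sum (charge k G X) X"
      using cut finX by (intro sum_mono2) (auto simp: cut_partition_def)
    finally show False
      using no_light[OF cut small] no_light[OF cut_partition_sym[OF indG cut] small] total k
      by simp
  qed
  moreover have "card {v \<in> X. nbrs_outside G X v \<noteq> {}} \<le> 2 * k\<^sup>2 - 1"
  proof -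
    have "card {v \<in> X. nbrs_outside G X v \<noteq> {}}
        \<le> sum (charge k G X) {v \<in> X. nbrs_outside G X v \<noteq> {}}"
      using sum_bounded_below[of "{v \<in> X. nbrs_outside G X v \<noteq> {}}" 1 "charge k G X"]
        k finite_nbrs_outside[OF G(1)]
      by (auto simp: charge_def Suc_le_eq card_gt_0_iff)
    also have "\<dots> \<le> sum (charge k G X) X"
      using finX by (intro sum_mono2) auto
    finally show ?thesis
      using total by simp
  qed
  moreover have "\<exists>v\<in>X. nbrs_outside G X v = {}"
    using low_charge_imp_interior[OF G(1) finX _ total x] deg sub by blast
  ultimately show ?thesis
    using that sub by blast
qed

section \<open>Cut-partitions with a side in the class\<close>

theorem theorem2p8:
  fixes k :: nat and \<G> :: "'a pair_pre_digraph set" and G :: "'a pair_pre_digraph"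
  assumes "k \<ge> 1"
    and "hereditary \<G>"
    and "G \<in> k_closure k \<G>"
  shows "G \<in> \<G> \<or>
    (\<exists>A B C. cut_partition G A B C \<and> pair_induce G A \<in> \<G> \<and> card C \<le> 2 * k\<^sup>2 - 1)"
proof (rule disjCI)
  assume no: "\<not> (\<exists>A B C. cut_partition G A B C \<and> pair_induce G A \<in> \<G> \<and> card C \<le> 2 * k\<^sup>2 - 1)"
  have nn: "nonnull_graph G"
    using nonnull_graph_k_closure assms by blast
  then have G: "pair_graph G" "pverts G \<noteq> {}" and finV: "finite (pverts G)"
    by (auto simp: nonnull_graph_def pair_graph_iff)
  have in_class: "pair_induce G S \<in> \<G>"
    if "S \<subseteq> pverts G" "S \<noteq> {}"
      "\<nexists>A B C. cut_partition (pair_induce G S) A B C \<and> card C \<le> k" for S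
    using k_closure_cut_partition[OF assms(2) k_closure_pair_induce[OF assms(2,3) that(1,2)]]
      that(3) by blast
  have single: "pair_induce G {v} \<in> \<G>" if "v \<in> pverts G" for v
  proof (rule in_class)
    have "\<not> cut_partition (pair_induce G {v}) A B C" for A B C
    proof
      assume "cut_partition (pair_induce G {v}) A B C"
      then have parts: "A \<union> B \<union> C = {v}" "A \<inter> B = {}" "A \<noteq> {}" "B \<noteq> {}"
        by (simp_all add: cut_partition_def)
      have "A \<subseteq> {v}" "B \<subseteq> {v}"
        unfolding parts(1)[symmetric] by auto
      with parts(3,4) have "A = {v}" "B = {v}"
        by (simp_all add: subset_singleton_iff)
      with parts(2) show False
        by simp
    qed
    then show "\<nexists>A B C. cut_partition (pair_induce G {v}) A B C \<and> card C \<le> k"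
      by blast
  qed (use that in auto)
  show "G \<in> \<G>"
  proof (rule ccontr)
    assume "G \<notin> \<G>"
    then obtain A B C where cut: "cut_partition G A B C"
      using k_closure_cut_partition assms by blast
    have large: "2 * k\<^sup>2 < card (pverts G)"
    proof (rule ccontr)
      assume small: "\<not> ?thesis"
      obtain a b where ab: "a \<in> A" "b \<in> B"
        using cut by (auto simp: cut_partition_def)
      then have "cut_partition G {a} {b} (pverts G - {a, b})"
        using cut by (auto simp: cut_partition_def)
      moreover have "card (pverts G - {a, b}) \<le> 2 * k\<^sup>2 - 1"
      proof -
        have "card (pverts G - {a, b}) \<le> card (pverts G - {a})"
          using finV by (intro card_mono) auto
        also have "\<dots> = card (pverts G) - 1"
          using ab cut by (intro card_Diff_singleton) (auto simp: cut_partition_def)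
        finally show ?thesis
          using small by linarith
      qed
      moreover have "a \<in> pverts G"
        using ab cut by (auto simp: cut_partition_def)
      ultimately show False
        using no single by blast
    qed
    have deg: "2 * k\<^sup>2 \<le> card (nbrs_outside G {} v)" if v: "v \<in> pverts G" for v
    proof (rule ccontr)
      assume less: "\<not> ?thesis"
      let ?N = "nbrs_outside G {} v"
      have "card (insert v ?N) < card (pverts G)"
        using less large card_insert_le_m1 finite_nbrs_outside[OF G(1), of "{}" v]
        by (simp add: card_insert_if)
      then have "pverts G - insert v ?N \<noteq> {}"
        using finite_nbrs_outside[OF G(1), of "{}" v]
        by (metis Diff_eq_empty_iff card_mono finite_insert not_le)
      then have "cut_partition G {v} (pverts G - insert v ?N) ?N"
        using v G by (auto simp: cut_partition_def nbrs_outside_def pair_graph_iff)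
      then show False
        using no single[OF v] less by force
    qed
    obtain X where X: "X \<subseteq> pverts G" "\<exists>v\<in>X. nbrs_outside G X v = {}"
      "card {v \<in> X. nbrs_outside G X v \<noteq> {}} \<le> 2 * k\<^sup>2 - 1"
      "\<nexists>A B C. cut_partition (pair_induce G X) A B C \<and> card C \<le> k"
      using isolated_subgraph_without_small_cut[OF G assms(1) deg] by blast
    let ?A = "{v \<in> X. nbrs_outside G X v = {}}" and ?C = "{v \<in> X. nbrs_outside G X v \<noteq> {}}"
    have XG: "pair_induce G X \<in> \<G>"
      using in_class X by blast
    then have "X \<noteq> pverts G"
      using \<open>G \<notin> \<G>\<close> pair_induce_pverts[OF G(1)] by auto
    then have "cut_partition G ?A (pverts G - X) ?C"
      using X(1,2) by (auto simp: cut_partition_def nbrs_outside_def)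
    moreover have "pair_induce G ?A \<in> \<G>"
    proof -
      have "pair_induce (pair_induce G X) ?A \<in> \<G>"
        using X(2) by (intro hereditary_pair_induce[OF assms(2) XG]) auto
      then show ?thesis
        by (simp add: pair_induce_induce)
    qed
    ultimately show False
      using no X(3) by blast
  qed
qed

end
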